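(* Let $G=M\rtimes\mathbf{Z}$ be a finitely generated group satisfying a law. Then either the action of $\mathbf{Z}$ contracts into a finitely generated subgroup of $M$, or the group $G$ is densely related.
   Context: A group $G$ satisfies a law if there exists a non-trivial element $w(x_1,\dots,x_k)$ of a free group on $x_1,\dots,x_k$ such that $w(g_1,\dots,g_k)=1$ for all $g_1,\dots,g_k\in G$. Let $\pi:G=M\rtimes\mathbf{Z}\to\mathbf{Z}$ be the projection. The action of $\mathbf{Z}$ contracts into a finitely generated subgroup of $M$ if there are an element $t\in G$ such that $\pi(t)$ is a generator of $\mathbf{Z}$ and a finitely generated subgroup $H\le M$ such that the sequence of subgroups $(t^{-n}Ht^{n})_{n\ge 0}$ is increasing with union $M$. Equivalently, $G$ decomposes as an ascending HNN-extension over a finitely generated group whose associated homomorphism onto $\mathbf{Z}$ is $\pi$ (up to sign). For a group $G$ with a generating subset $S$, let $F_S$ be the free group on $S$ with its word length, let $N$ be the kernel of the natural map $F_S\to G$, and for $n\ge 0$ let $N_n$ be the normal subgroup of $F_S$ generated (as a normal subgroup) by the elements of $N$ of length at most $n$ ($N_{-1}$ is trivial). The relation range $\mathcal{R}_S(G)$ is the set of integers $n\ge 0$ such that $N_n$ properly contains $N_{n-1}$. A finitely generated group $G$ is densely related if, for a finite generating subset $S$, there exists $c>0$ such that for all integers $n\ge 1$ we have $\mathcal{R}_S(G)\cap[n,cn]\neq\emptyset$ (this does not depend on $S$). *)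

theory Defs
  imports Complex_Main "HOL-Algebra.Elementary_Groups" "HOL-Algebra.Generated_Groups"
begin

(* The letter (True, x) stands for x and (False, x) for its inverse; the free group on X
   consists of the reduced words over X, so word length is the length of the list. *)

definition letter_inv :: "bool \<times> 'x \<Rightarrow> bool \<times> 'x" where
  "letter_inv a = (\<not> fst a, snd a)"

definition reduced :: "(bool \<times> 'x) list \<Rightarrow> bool" where
  "reduced w \<longleftrightarrow> successively (\<lambda>a b. b \<noteq> letter_inv a) w"

definition cons_red :: "bool \<times> 'x \<Rightarrow> (bool \<times> 'x) list \<Rightarrow> (bool \<times> 'x) list" where
  "cons_red a w = (if w \<noteq> [] \<and> hd w = letter_inv a then tl w else a # w)"

definition free_group :: "'x set \<Rightarrow> (bool \<times> 'x) list monoid" where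
  "free_group X =
     \<lparr>carrier = {w. reduced w \<and> set w \<subseteq> UNIV \<times> X},
      mult = (\<lambda>u v. foldr cons_red u v),
      one = []\<rparr>"

primrec word_eval :: "('a, 'b) monoid_scheme \<Rightarrow> ('x \<Rightarrow> 'a) \<Rightarrow> (bool \<times> 'x) list \<Rightarrow> 'a" where
  "word_eval G g [] = \<one>\<^bsub>G\<^esub>"
| "word_eval G g (a # w) =
     (if fst a then g (snd a) else inv\<^bsub>G\<^esub> (g (snd a))) \<otimes>\<^bsub>G\<^esub> word_eval G g w"

lemma letter_inv_letter_inv [simp]: "letter_inv (letter_inv a) = a"
  by (simp add: letter_inv_def)

lemma reduced_Nil [simp]: "reduced []"
  by (simp add: reduced_def)

lemma reduced_Cons: "reduced (a # w) \<longleftrightarrow> (w = [] \<or> hd w \<noteq> letter_inv a) \<and> reduced w"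
  by (cases w) (auto simp: reduced_def)

lemma reduced_cons_red: "reduced w \<Longrightarrow> reduced (cons_red a w)"
  by (cases w) (auto simp: cons_red_def reduced_Cons)

lemma cons_red_cancel: "reduced w \<Longrightarrow> cons_red (letter_inv a) (cons_red a w) = w"
  by (cases w) (auto simp: cons_red_def reduced_Cons)

lemma reduced_foldr_cons_red: "reduced v \<Longrightarrow> reduced (foldr cons_red u v)"
  by (induction u) (auto intro: reduced_cons_red)

lemma foldr_cons_red_Nil: "reduced u \<Longrightarrow> foldr cons_red u [] = u"
  by (induction u) (auto simp: reduced_Cons cons_red_def)

lemma foldr_cons_red_cons_red:
  assumes "reduced w"
  shows "foldr cons_red (cons_red a v) w = cons_red a (foldr cons_red v w)"
proof (cases "v \<noteq> [] \<and> hd v = letter_inv a")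
  case True
  then obtain v' where v: "v = letter_inv a # v'" by (cases v) auto
  show ?thesis
    using cons_red_cancel[OF reduced_foldr_cons_red[OF assms, of v'], of "letter_inv a"]
    by (simp add: v cons_red_def[of a "letter_inv a # v'"])
qed (auto simp: cons_red_def[of a v])

lemma foldr_cons_red_assoc:
  assumes "reduced w"
  shows "foldr cons_red (foldr cons_red u v) w = foldr cons_red u (foldr cons_red v w)"
  by (induction u) (auto simp: foldr_cons_red_cons_red[OF assms])

lemma foldr_cons_red_rev:
  "reduced w \<Longrightarrow> foldr cons_red (rev (map letter_inv u)) (foldr cons_red u w) = w"
  by (induction u arbitrary: w) (auto simp: cons_red_cancel reduced_foldr_cons_red)

lemma set_foldr_cons_red: "set (foldr cons_red u v) \<subseteq> set u \<union> set v"
proof (induction u)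
  case (Cons a u)
  have "set (cons_red a w) \<subseteq> insert a (set w)" for w
    by (cases w) (auto simp: cons_red_def)
  then show ?case
    using Cons by fastforce
qed simp

lemma free_group_mult_closed:
  assumes "u \<in> carrier (free_group X)" "v \<in> carrier (free_group X)"
  shows "u \<otimes>\<^bsub>free_group X\<^esub> v \<in> carrier (free_group X)"
  using assms set_foldr_cons_red[of u v]
  by (auto simp: free_group_def reduced_foldr_cons_red)

theorem group_free_group: "group (free_group X)"
proof (rule groupI)
  show "\<exists>v\<in>carrier (free_group X). v \<otimes>\<^bsub>free_group X\<^esub> u = \<one>\<^bsub>free_group X\<^esub>"
    if u: "u \<in> carrier (free_group X)" for u
  proof (rule bexI)
    let ?v = "foldr cons_red (rev (map letter_inv u)) []"
    show "?v \<otimes>\<^bsub>free_group X\<^esub> u = \<one>\<^bsub>free_group X\<^esub>"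
      using u foldr_cons_red_rev[of "[]" u]
      by (simp add: free_group_def foldr_cons_red_assoc foldr_cons_red_Nil)
    show "?v \<in> carrier (free_group X)"
      using u set_foldr_cons_red[of "rev (map letter_inv u)" "[]"]
      by (force simp: free_group_def reduced_foldr_cons_red letter_inv_def)
  qed
qed (auto simp: free_group_mult_closed, auto simp: free_group_def foldr_cons_red_assoc)

lemma (in group) word_eval_closed:
  assumes "g \<in> X \<rightarrow> carrier G" "set w \<subseteq> UNIV \<times> X"
  shows "word_eval G g w \<in> carrier G"
  using assms by (induction w) (auto simp: Pi_iff)

lemma (in group) word_eval_cons_red:
  assumes "g \<in> X \<rightarrow> carrier G" "snd a \<in> X" "set w \<subseteq> UNIV \<times> X"
  shows "word_eval G g (cons_red a w) = word_eval G g (a # w)"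
proof (cases "w \<noteq> [] \<and> hd w = letter_inv a")
  case True
  then obtain v where w: "w = letter_inv a # v" by (cases w) auto
  have "g (snd a) \<in> carrier G" "word_eval G g v \<in> carrier G"
    using assms w by (auto intro: word_eval_closed[of g X])
  then show ?thesis
    by (auto simp: w cons_red_def letter_inv_def simp flip: m_assoc)
qed (auto simp: cons_red_def)

theorem (in group) word_eval_hom:
  assumes g: "g \<in> X \<rightarrow> carrier G"
  shows "word_eval G g \<in> hom (free_group X) G"
proof (rule homI)
  fix u v assume u: "u \<in> carrier (free_group X)" and v: "v \<in> carrier (free_group X)"
  have "set u \<subseteq> UNIV \<times> X" "set v \<subseteq> UNIV \<times> X"
    using u v by (auto simp: free_group_def)
  then have "word_eval G g (foldr cons_red u v) = word_eval G g u \<otimes> word_eval G g v"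
  proof (induction u)
    case Nil
    then show ?case using word_eval_closed[OF g] by simp
  next
    case (Cons a u)
    have "set (foldr cons_red u v) \<subseteq> UNIV \<times> X"
      using Cons.prems set_foldr_cons_red[of u v] by auto
    moreover have "g (snd a) \<in> carrier G" "word_eval G g u \<in> carrier G"
      "word_eval G g v \<in> carrier G"
      using Cons.prems g by (auto intro: word_eval_closed[OF g])
    ultimately show ?case
      using Cons word_eval_cons_red[OF g, of a "foldr cons_red u v"] by (auto simp: m_assoc)
  qed
  then show "word_eval G g (u \<otimes>\<^bsub>free_group X\<^esub> v) = word_eval G g u \<otimes> word_eval G g v"
    by (simp add: free_group_def)
qed (auto simp: free_group_def intro: word_eval_closed[OF g])

definition satisfies_law :: "('a, 'b) monoid_scheme \<Rightarrow> bool" where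
  "satisfies_law G \<longleftrightarrow>
     (\<exists>(k::nat) w. w \<in> carrier (free_group {1..k}) \<and> w \<noteq> \<one>\<^bsub>free_group {1..k}\<^esub> \<and>
        (\<forall>g \<in> {1..k} \<rightarrow> carrier G. word_eval G g w = \<one>\<^bsub>G\<^esub>))"

definition finitely_generated :: "('a, 'b) monoid_scheme \<Rightarrow> bool" where
  "finitely_generated G \<longleftrightarrow> (\<exists>S. finite S \<and> S \<subseteq> carrier G \<and> generate G S = carrier G)"

(* Internal semidirect product: G = M Q, where Q is the isomorphic image of the integers
   under \<sigma>; \<pi> is the resulting projection of G. *)
definition semidirect_int ::
  "('a, 'b) monoid_scheme \<Rightarrow> 'a set \<Rightarrow> (int \<Rightarrow> 'a) \<Rightarrow> ('a \<Rightarrow> int) \<Rightarrow> bool" where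
  "semidirect_int G M \<sigma> \<pi> \<longleftrightarrow>
     group G \<and> M \<lhd> G \<and>
     (\<exists>Q. subgroup Q G \<and> M \<inter> Q = {\<one>\<^bsub>G\<^esub>} \<and> M <#>\<^bsub>G\<^esub> Q = carrier G \<and>
          \<sigma> \<in> iso integer_group (G\<lparr>carrier := Q\<rparr>)) \<and>
     (\<forall>m\<in>M. \<forall>k. \<pi> (m \<otimes>\<^bsub>G\<^esub> \<sigma> k) = k)"

definition contracts_into_fg ::
  "('a, 'b) monoid_scheme \<Rightarrow> 'a set \<Rightarrow> ('a \<Rightarrow> int) \<Rightarrow> bool" where
  "contracts_into_fg G M \<pi> \<longleftrightarrow>
     (\<exists>t\<in>carrier G. generate integer_group {\<pi> t} = carrier integer_group \<and>
        (\<exists>H. subgroup H G \<and> H \<subseteq> M \<and> finitely_generated (G\<lparr>carrier := H\<rparr>) \<and>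
           (let K = (\<lambda>n::nat. (\<lambda>h. inv\<^bsub>G\<^esub> (t [^]\<^bsub>G\<^esub> n) \<otimes>\<^bsub>G\<^esub> h \<otimes>\<^bsub>G\<^esub> t [^]\<^bsub>G\<^esub> n) ` H)
            in mono K \<and> (\<Union>n. K n) = M)))"

definition normal_closure :: "('a, 'b) monoid_scheme \<Rightarrow> 'a set \<Rightarrow> 'a set" where
  "normal_closure G R = \<Inter> {K. K \<lhd> G \<and> R \<subseteq> K}"

definition relators :: "('a, 'b) monoid_scheme \<Rightarrow> 'a set \<Rightarrow> (bool \<times> 'a) list set" where
  "relators G S = kernel (free_group S) G (word_eval G (\<lambda>x. x))"

definition short_relators_closure ::
  "('a, 'b) monoid_scheme \<Rightarrow> 'a set \<Rightarrow> int \<Rightarrow> (bool \<times> 'a) list set" where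
  "short_relators_closure G S n =
     normal_closure (free_group S) {w \<in> relators G S. int (length w) \<le> n}"

definition relation_range :: "('a, 'b) monoid_scheme \<Rightarrow> 'a set \<Rightarrow> nat set" where
  "relation_range G S =
     {n. short_relators_closure G S (int n - 1) \<subset> short_relators_closure G S (int n)}"

definition densely_related :: "('a, 'b) monoid_scheme \<Rightarrow> bool" where
  "densely_related G \<longleftrightarrow>
     (\<exists>S. finite S \<and> S \<subseteq> carrier G \<and> generate G S = carrier G \<and>
        (\<exists>c>0. \<forall>n::nat\<ge>1. \<exists>r\<in>relation_range G S. real n \<le> real r \<and> real r \<le> c * real n))"

(* At level -1 there are no relators at all. *)
lemma short_relators_closure_minus_one:
  "short_relators_closure G S (-1) = {\<one>\<^bsub>free_group S\<^esub>}"
proof -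
  interpret F: group "free_group S" by (rule group_free_group)
  have "normal {\<one>\<^bsub>free_group S\<^esub>} (free_group S)"
    by (rule F.one_is_normal)
  moreover have "\<one>\<^bsub>free_group S\<^esub> \<in> K" if "K \<lhd> free_group S" for K
    using that by (auto simp: normal_def subgroup.one_closed)
  ultimately show ?thesis
    by (auto simp: short_relators_closure_def normal_closure_def)
qed

end

(* Choose generators t, y_1, ..., y_d with \<pi>(t) = 1 and all y_i in M; fix n, put N = 2n, and let
   A be the subgroup of M generated by the t^k y_i t^-k with 0 \<le> k < N.  If t A t^-1 \<subseteq> A or
   t^-1 A t \<subseteq> A, the action contracts into A.  Otherwise x = t^N y_i t^-N is not in A for some i,
   and t^-1 y_j t is not in A for some j; write y = y_j.

   The free group on the generators acts on G \<times> F, where F is the free group on the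
   right cosets of A, by t (g, f) = (t g, [A g] f) and y_i (g, f) = (y_i g, f).  Since
   A (b g) = A g for b in A, the element t^k y_i t^-k acts as a translation of the first factor
   for 0 \<le> k \<le> N, so every relator of length at most n acts trivially.  This replaces the HNN
   extension with associated subgroups A and t A t^-1: the letters produced by t^(+-1) b t^(-+1)
   cancel precisely for the pinches of Britton's lemma.

   The words u_i = t^(2i) x t^-1 y t x^-1 t^-(2i+1) have length O(n), and no pinch occurs in a
   reduced word in the u_i.  Hence the law evaluated at the u_i is a relator of length O(n) that
   does not follow from the relators of length less than n. *)

theory Submission
  imports Defs
begin

section \<open>Lengths under free reduction, right cosets and evaluation of words\<close>

lemma length_cons_red: "length (cons_red a w) \<le> Suc (length w)"
  by (auto simp: cons_red_def)

lemma length_foldr_cons_red: "length (foldr cons_red u v) \<le> length u + length v"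
proof (induction u)
  case (Cons a u)
  show ?case
    using Cons length_cons_red[of a "foldr cons_red u v"] by simp
qed simp

context group
begin

text \<open>The cancellation test of the whole development: letters are labelled by right cosets,
  and two opposite letters cancel precisely when the element between them lies in the relevant
  subgroup.\<close>

lemma r_coset_mult_eq_iff:
  assumes A: "subgroup A G" and x: "x \<in> carrier G" and g: "g \<in> carrier G"
  shows "A #> (x \<otimes> g) = A #> g \<longleftrightarrow> x \<in> A"
proof
  assume "x \<in> A"
  then show "A #> (x \<otimes> g) = A #> g"
    using coset_mult_assoc[of A x g] coset_join2[OF x A] subgroup.subset[OF A] x g by simp
next
  assume eq: "A #> (x \<otimes> g) = A #> g"
  have "x \<otimes> g \<in> A #> (x \<otimes> g)"
    using rcos_self[OF _ A] x g by simp
  then obtain a where a: "a \<in> A" "x \<otimes> g = a \<otimes> g"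
    unfolding eq unfolding r_coset_def by auto
  then show "x \<in> A"
    using x g subgroup.mem_carrier[OF A a(1)] by simp
qed

lemma word_eval_append:
  assumes "g \<in> X \<rightarrow> carrier G" "set u \<subseteq> UNIV \<times> X" "set v \<subseteq> UNIV \<times> X"
  shows "word_eval G g (u @ v) = word_eval G g u \<otimes> word_eval G g v"
  using assms(2)
proof (induction u)
  case Nil
  then show ?case using word_eval_closed[OF assms(1,3)] by simp
next
  case (Cons a u)
  then have "g (snd a) \<in> carrier G" "word_eval G g u \<in> carrier G" "word_eval G g v \<in> carrier G"
    using assms by (auto intro: word_eval_closed[OF assms(1)])
  then show ?case using Cons by (auto simp: m_assoc)
qed

lemma word_eval_rev_letter_inv:
  assumes g: "g \<in> X \<rightarrow> carrier G" and u: "set u \<subseteq> UNIV \<times> X"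
  shows "word_eval G g (rev (map letter_inv u)) = inv (word_eval G g u)"
  using u
proof (induction u)
  case (Cons a u)
  have 1: "set (rev (map letter_inv u)) \<subseteq> UNIV \<times> X" "set [letter_inv a] \<subseteq> UNIV \<times> X"
    using Cons.prems by (auto simp: letter_inv_def)
  have 2: "g (snd a) \<in> carrier G" "word_eval G g u \<in> carrier G"
    using Cons.prems g by (auto intro: word_eval_closed[OF g])
  show ?case
    using Cons 2 word_eval_append[OF g 1]
    by (auto simp: letter_inv_def[of a] inv_mult_group)
qed simp

lemma word_eval_foldr_cons_red_Nil:
  assumes g: "g \<in> X \<rightarrow> carrier G" and u: "set u \<subseteq> UNIV \<times> X"
  shows "word_eval G g (foldr cons_red u []) = word_eval G g u"
  using u
proof (induction u)
  case (Cons a u)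
  have "set (foldr cons_red u []) \<subseteq> UNIV \<times> X"
    using Cons.prems set_foldr_cons_red[of u "[]"] by auto
  then show ?case
    using Cons word_eval_cons_red[OF g, of a "foldr cons_red u []"] by auto
qed simp

text \<open>Substitution of words for letters, which is how a law in abstract letters is turned into
  a relator over the generators. The blocks may be unreduced.\<close>

lemma word_eval_concat:
  assumes g: "g \<in> X \<rightarrow> carrier G"
    and U: "\<And>a. a \<in> set w \<Longrightarrow> set (U a) \<subseteq> UNIV \<times> X"
    and inv: "\<And>i. (False, i) \<in> set w \<Longrightarrow> U (False, i) = rev (map letter_inv (U (True, i)))"
  shows "word_eval G g (concat (map U w)) = word_eval G (\<lambda>i. word_eval G g (U (True, i))) w"
  using U inv
proof (induction w)
  case (Cons a w)
  have a: "set (U a) \<subseteq> UNIV \<times> X" and w: "set (concat (map U w)) \<subseteq> UNIV \<times> X"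
    using Cons.prems(1) by fastforce+
  have "word_eval G g (U a) =
      (if fst a then word_eval G g (U (True, snd a)) else inv (word_eval G g (U (True, snd a))))"
  proof (cases "fst a")
    case True
    then show ?thesis by (metis prod.collapse)
  next
    case False
    then have a': "a = (False, snd a)" by (metis prod.collapse)
    have Ua: "U a = rev (map letter_inv (U (True, snd a)))"
      using Cons.prems(2)[of "snd a"] a' by simp
    have "set (U (True, snd a)) \<subseteq> UNIV \<times> X"
      using a unfolding Ua by (force simp: letter_inv_def)
    then show ?thesis
      using Ua False word_eval_rev_letter_inv[OF g] by simp
  qed
  then show ?case
    using Cons word_eval_append[OF g a w] by simp
qed simp

text \<open>Conjugation by \<open>s\<close> is a homomorphism, so an inclusion between subgroups can
  be tested on generators. It is applied with \<open>s\<close> equal to \<open>t\<close> and to its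
  inverse.\<close>

lemma conj_generate_subset:
  assumes C: "C \<subseteq> carrier G" and s: "s \<in> carrier G" and H: "subgroup H G"
    and conj: "\<And>c. c \<in> C \<Longrightarrow> s \<otimes> c \<otimes> inv s \<in> H"
    and h: "h \<in> generate G C"
  shows "s \<otimes> h \<otimes> inv s \<in> H"
  using h
proof (induction h rule: generate.induct)
  case one
  then show ?case using s subgroup.one_closed[OF H] by simp
next
  case (incl h)
  then show ?case using conj by simp
next
  case (inv h)
  have "s \<otimes> inv h \<otimes> inv s = inv (s \<otimes> h \<otimes> inv s)"
    using inv C s by (auto simp: inv_mult_group m_assoc)
  then show ?case using conj[OF inv] subgroup.m_inv_closed[OF H] by simp
next
  case (eng h1 h2)
  have "h1 \<in> carrier G" "h2 \<in> carrier G"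
    using eng generate_in_carrier[OF C] by auto
  then have "s \<otimes> (h1 \<otimes> h2) \<otimes> inv s = (s \<otimes> h1 \<otimes> inv s) \<otimes> (s \<otimes> h2 \<otimes> inv s)"
    using s by (simp add: m_assoc inv_solve_left)
  then show ?case using eng subgroup.m_closed[OF H] by simp
qed

end

section \<open>The action of words on pairs of a group element and a reduced word in cosets of
  \<open>A\<close>\<close>

locale coset_extension = group G for G (structure) +
  fixes A :: "'a set" and t :: 'a
  assumes subgroup_A: "subgroup A G" and t_closed [simp]: "t \<in> carrier G"
begin

text \<open>Reducedness makes \<open>cons_red_cancel\<close> applicable, so that \<open>lift\<close>
  and \<open>lower\<close> are inverse bijections. Letters may be arbitrary sets; the action itself
  only adds cosets of \<open>A\<close>.\<close>

definition states :: "('a \<times> (bool \<times> 'a set) list) set" where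
  "states = carrier G \<times> {f. reduced f}"

definition lift :: "'a \<times> (bool \<times> 'a set) list \<Rightarrow> 'a \<times> (bool \<times> 'a set) list" where
  "lift z = (t \<otimes> fst z, cons_red (True, A #> fst z) (snd z))"

text \<open>The label is the coset of the element arrived at, because this letter has to undo the
  one that \<open>lift\<close> adds when it departs from that element.\<close>

definition lower :: "'a \<times> (bool \<times> 'a set) list \<Rightarrow> 'a \<times> (bool \<times> 'a set) list" where
  "lower z = (inv t \<otimes> fst z, cons_red (False, A #> (inv t \<otimes> fst z)) (snd z))"

definition shift :: "'a \<Rightarrow> 'a \<times> (bool \<times> 'a set) list \<Rightarrow> 'a \<times> (bool \<times> 'a set) list" where
  "shift b z = (b \<otimes> fst z, snd z)"

definition step :: "bool \<times> 'a \<Rightarrow> 'a \<times> (bool \<times> 'a set) list \<Rightarrow> 'a \<times> (bool \<times> 'a set) list" where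
  "step a = (if snd a = t then if fst a then lift else lower
             else shift (if fst a then snd a else inv (snd a)))"

definition act :: "(bool \<times> 'a) list \<Rightarrow> 'a \<times> (bool \<times> 'a set) list \<Rightarrow> 'a \<times> (bool \<times> 'a set) list"
  where "act = foldr step"

lemma act_simps [simp]:
  "act [] z = z" "act (a # w) z = step a (act w z)" "act (u @ v) z = act u (act v z)"
  by (auto simp: act_def)

lemma act_replicate: "act (replicate k a) z = (step a ^^ k) z"
  by (induction k) auto

lemma lift_closed [simp]: "z \<in> states \<Longrightarrow> lift z \<in> states"
  by (auto simp: states_def lift_def reduced_cons_red)

lemma lower_closed [simp]: "z \<in> states \<Longrightarrow> lower z \<in> states"
  by (auto simp: states_def lower_def reduced_cons_red)

lemma shift_closed [simp]: "b \<in> carrier G \<Longrightarrow> z \<in> states \<Longrightarrow> shift b z \<in> states"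
  by (auto simp: states_def shift_def)

lemma lift_pow_closed [simp]: "z \<in> states \<Longrightarrow> (lift ^^ k) z \<in> states"
  by (induction k) auto

lemma lower_pow_closed [simp]: "z \<in> states \<Longrightarrow> (lower ^^ k) z \<in> states"
  by (induction k) auto

lemma lower_lift [simp]: "z \<in> states \<Longrightarrow> lower (lift z) = z"
  using cons_red_cancel[of "snd z" "(True, A #> fst z)"]
  by (auto simp: states_def lift_def lower_def letter_inv_def simp flip: m_assoc)

lemma lift_lower [simp]: "z \<in> states \<Longrightarrow> lift (lower z) = z"
  using cons_red_cancel[of "snd z" "(False, A #> (inv t \<otimes> fst z))"]
  by (auto simp: states_def lift_def lower_def letter_inv_def simp flip: m_assoc)

lemma shift_shift [simp]:
  "b \<in> carrier G \<Longrightarrow> c \<in> carrier G \<Longrightarrow> z \<in> states \<Longrightarrow> shift b (shift c z) = shift (b \<otimes> c) z"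
  by (auto simp: shift_def states_def m_assoc)

lemma shift_one [simp]: "z \<in> states \<Longrightarrow> shift \<one> z = z"
  by (auto simp: shift_def states_def)

lemma lower_pow_lift_pow: "z \<in> states \<Longrightarrow> (lower ^^ k) ((lift ^^ k) z) = z"
proof (induction k)
  case (Suc k)
  then show ?case
    by (simp add: funpow_swap1[of lower])
qed simp

lemma lift_pow_lower_pow: "z \<in> states \<Longrightarrow> (lift ^^ k) ((lower ^^ k) z) = z"
proof (induction k)
  case (Suc k)
  then show ?case
    by (simp add: funpow_swap1[of lift])
qed simp

lemma step_closed [simp]: "snd a \<in> carrier G \<Longrightarrow> z \<in> states \<Longrightarrow> step a z \<in> states"
  by (auto simp: step_def)

lemma act_closed [simp]: "set w \<subseteq> UNIV \<times> carrier G \<Longrightarrow> z \<in> states \<Longrightarrow> act w z \<in> states"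
  by (induction w) auto

lemma step_letter_inv:
  "snd a \<in> carrier G \<Longrightarrow> z \<in> states \<Longrightarrow> step a (step (letter_inv a) z) = z"
  by (auto simp: step_def letter_inv_def)

lemma act_cons_red:
  assumes "snd a \<in> carrier G" "set w \<subseteq> UNIV \<times> carrier G" "z \<in> states"
  shows "act (cons_red a w) z = step a (act w z)"
proof (cases "w \<noteq> [] \<and> hd w = letter_inv a")
  case True
  then obtain v where w: "w = letter_inv a # v" by (cases w) auto
  then have "act v z \<in> states" using assms by auto
  then show ?thesis
    using assms(1) by (simp add: w cons_red_def step_letter_inv)
qed (auto simp: cons_red_def)

lemma act_foldr_cons_red:
  assumes "set u \<subseteq> UNIV \<times> carrier G" "set v \<subseteq> UNIV \<times> carrier G" "z \<in> states"
  shows "act (foldr cons_red u v) z = act u (act v z)"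
  using assms(1)
proof (induction u)
  case (Cons a u)
  have "set (foldr cons_red u v) \<subseteq> UNIV \<times> carrier G"
    using Cons.prems assms(2) set_foldr_cons_red[of u v] by auto
  then show ?case
    using Cons assms(3) act_cons_red[of a "foldr cons_red u v" z] by auto
qed simp

lemma fst_act:
  assumes "set w \<subseteq> UNIV \<times> carrier G" "z \<in> states"
  shows "fst (act w z) = word_eval G (\<lambda>x. x) w \<otimes> fst z"
  using assms(1)
proof (induction w)
  case Nil
  then show ?case using assms(2) by (auto simp: states_def)
next
  case (Cons a w)
  have "word_eval G (\<lambda>x. x) w \<in> carrier G" "fst z \<in> carrier G" "snd a \<in> carrier G"
    using Cons.prems assms(2) by (auto simp: states_def intro: word_eval_closed[of _ "carrier G"])
  then show ?case
    using Cons by (auto simp: step_def lift_def lower_def shift_def m_assoc)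
qed

text \<open>A normal closure lies in every normal subgroup containing its generators. Once short
  relators are known to act trivially, a word that moves some state therefore cannot follow from
  them.\<close>

lemma act_kernel_normal:
  assumes S: "S \<subseteq> carrier G"
  shows "{w \<in> carrier (free_group S). \<forall>z\<in>states. act w z = z} \<lhd> free_group S"
    (is "?N \<lhd> ?F")
proof -
  interpret F: group ?F by (rule group_free_group)
  have set: "set u \<subseteq> UNIV \<times> carrier G" if "u \<in> carrier ?F" for u
    using that S by (auto simp: free_group_def)
  have mult: "act (u \<otimes>\<^bsub>?F\<^esub> v) z = act u (act v z)"
    if "u \<in> carrier ?F" "v \<in> carrier ?F" "z \<in> states" for u v z
    using act_foldr_cons_red[OF set[OF that(1)] set[OF that(2)] that(3)]
    by (simp add: free_group_def)
  have one: "act \<one>\<^bsub>?F\<^esub> z = z" for z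
    by (simp add: free_group_def)
  have inv: "act u (act (inv\<^bsub>?F\<^esub> u) z) = z" "act (inv\<^bsub>?F\<^esub> u) (act u z) = z"
    if "u \<in> carrier ?F" "z \<in> states" for u z
    using mult[of u "inv\<^bsub>?F\<^esub> u" z] mult[of "inv\<^bsub>?F\<^esub> u" u z] that one by auto
  have "subgroup ?N ?F"
  proof (rule F.subgroupI)
    show "?N \<noteq> {}" using one by blast
    show "inv\<^bsub>?F\<^esub> u \<in> ?N" if "u \<in> ?N" for u
      using that inv(2)[of u] by auto
    show "u \<otimes>\<^bsub>?F\<^esub> v \<in> ?N" if "u \<in> ?N" "v \<in> ?N" for u v
      using that mult by auto
  qed auto
  moreover have "u \<otimes>\<^bsub>?F\<^esub> r \<otimes>\<^bsub>?F\<^esub> inv\<^bsub>?F\<^esub> u \<in> ?N" if "u \<in> carrier ?F" "r \<in> ?N" for u r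
  proof -
    have "act (u \<otimes>\<^bsub>?F\<^esub> r \<otimes>\<^bsub>?F\<^esub> inv\<^bsub>?F\<^esub> u) z = z" if z: "z \<in> states" for z
    proof -
      have "act (inv\<^bsub>?F\<^esub> u) z \<in> states"
        using \<open>u \<in> carrier ?F\<close> z act_closed[OF set] by simp
      then show ?thesis
        using \<open>u \<in> carrier ?F\<close> \<open>r \<in> ?N\<close> z inv(1) by (simp add: mult)
    qed
    then show ?thesis using that by auto
  qed
  ultimately show ?thesis
    by (simp add: F.normal_inv_iff)
qed

text \<open>For \<open>b\<close> in \<open>A\<close> the elements \<open>b g\<close> and
  \<open>g\<close> lie in the same coset, so \<open>lift\<close> adds the same letter at both and
  only the first coordinate changes.\<close>

lemma lift_shift:
  assumes "b \<in> A" "z \<in> states"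
  shows "lift (shift b z) = shift (t \<otimes> b \<otimes> inv t) (lift z)"
proof -
  have "b \<in> carrier G" "fst z \<in> carrier G"
    using assms subgroup.mem_carrier[OF subgroup_A] by (auto simp: states_def)
  then show ?thesis
    using assms r_coset_mult_eq_iff[OF subgroup_A, of b "fst z"]
    by (simp add: lift_def shift_def m_assoc inv_solve_left)
qed

text \<open>The \<open>j\<close>-th lift has to absorb the conjugate by the exponent reached before
  it, hence \<open>j < k\<close>. The conjugate by \<open>t [^] k\<close> itself may lie outside
  \<open>A\<close>; this off-by-one is what later makes room for the element
  \<open>x\<close>.\<close>

lemma lift_pow_shift:
  assumes b: "b \<in> carrier G" and z: "z \<in> states"
    and conj: "\<And>j. j < k \<Longrightarrow> t [^] j \<otimes> b \<otimes> inv (t [^] j) \<in> A"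
  shows "(lift ^^ k) (shift b z) = shift (t [^] k \<otimes> b \<otimes> inv (t [^] k)) ((lift ^^ k) z)"
  using conj
proof (induction k)
  case 0
  then show ?case using b by simp
next
  case (Suc k)
  have "t \<otimes> (t [^] k \<otimes> b \<otimes> inv (t [^] k)) \<otimes> inv t = t [^] Suc k \<otimes> b \<otimes> inv (t [^] Suc k)"
    using b nat_pow_Suc2[OF t_closed, of k]
    by (simp add: m_assoc inv_mult_group del: nat_pow_Suc)
  then show ?case
    using Suc z lift_shift[of "t [^] k \<otimes> b \<otimes> inv (t [^] k)" "(lift ^^ k) z"] by simp
qed

text \<open>\<open>pos\<close> and \<open>neg\<close> describe a state reached by a \<open>lift\<close>, respectively a \<open>lower\<close>, that did not cancel.\<close>

definition pos :: "'a \<times> (bool \<times> 'a set) list \<Rightarrow> bool" where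
  "pos z \<longleftrightarrow> snd z \<noteq> [] \<and> hd (snd z) = (True, A #> (inv t \<otimes> fst z))"

definition neg :: "'a \<times> (bool \<times> 'a set) list \<Rightarrow> bool" where
  "neg z \<longleftrightarrow> snd z \<noteq> [] \<and> hd (snd z) = (False, A #> fst z)"

text \<open>A new \<open>True\<close> letter can cancel only against a \<open>False\<close>
  head.\<close>

lemma pos_lift:
  assumes "z \<in> states" "snd z = [] \<or> fst (hd (snd z))"
  shows "pos (lift z)"
  using assms by (auto simp: pos_def lift_def cons_red_def letter_inv_def states_def simp flip: m_assoc)

lemma neg_lower:
  assumes "snd z = [] \<or> \<not> fst (hd (snd z))"
  shows "neg (lower z)"
  using assms by (auto simp: neg_def lower_def cons_red_def letter_inv_def)

text \<open>The subword \<open>t b t^-1\<close> with \<open>b\<close> outside \<open>A\<close> is no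
  pinch: the head carries the coset of \<open>fst z\<close> and the new letter that of
  \<open>b\<close> times \<open>fst z\<close>, and these differ.\<close>

lemma pos_lift_shift:
  assumes z: "z \<in> states" "neg z" and b: "b \<in> carrier G" "b \<notin> A"
  shows "pos (lift (shift b z))"
proof -
  have g: "fst z \<in> carrier G" using z by (auto simp: states_def)
  show ?thesis
    using z(2) b g r_coset_mult_eq_iff[OF subgroup_A b(1) g]
    by (auto simp: neg_def pos_def lift_def shift_def cons_red_def letter_inv_def simp flip: m_assoc)
qed

text \<open>The other kind of pinch, \<open>t^-1 b t\<close>: after moving \<open>t\<close> past
  \<open>b\<close>, the two cosets differ by left multiplication with
  \<open>t^-1 b t\<close>.\<close>

lemma neg_lower_shift:
  assumes z: "z \<in> states" "pos z" and b: "b \<in> carrier G" "inv t \<otimes> b \<otimes> t \<notin> A"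
  shows "neg (lower (shift b z))"
proof -
  have g: "fst z \<in> carrier G" using z by (auto simp: states_def)
  have "t \<otimes> (inv t \<otimes> fst z) = fst z"
    using g by (simp flip: m_assoc)
  then have "inv t \<otimes> (b \<otimes> fst z) = (inv t \<otimes> b \<otimes> t) \<otimes> (inv t \<otimes> fst z)"
    using b g by (simp add: m_assoc)
  then show ?thesis
    using z(2) b g r_coset_mult_eq_iff[OF subgroup_A, of "inv t \<otimes> b \<otimes> t" "inv t \<otimes> fst z"]
    by (auto simp: neg_def pos_def lower_def shift_def cons_red_def letter_inv_def)
qed

lemma pos_lift_pow:
  assumes "z \<in> states" "pos (lift z)"
  shows "pos ((lift ^^ Suc k) z)"
proof (induction k)
  case (Suc k)
  have "pos (lift ((lift ^^ Suc k) z))"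
    using Suc assms(1) by (intro pos_lift lift_pow_closed) (auto simp: pos_def)
  then show ?case by simp
qed (use assms in simp)

lemma neg_lower_pow:
  assumes "neg (lower z)"
  shows "neg ((lower ^^ Suc k) z)"
proof (induction k)
  case (Suc k)
  have "neg (lower ((lower ^^ Suc k) z))"
    using Suc by (intro neg_lower) (auto simp: neg_def)
  then show ?case by simp
qed (use assms in simp)

text \<open>The conjugating exponent follows the height of the suffix read so far, so it stays between 0 and \<open>N\<close> and
  the letters produced by \<open>t\<close> are absorbed at every step.\<close>

lemma act_bounded_word:
  assumes M: "M \<lhd> G" and Y: "Y \<subseteq> M"
    and conj: "\<And>m j. m \<in> Y \<Longrightarrow> j < N \<Longrightarrow> t [^] j \<otimes> m \<otimes> inv (t [^] j) \<in> A"
    and w: "set w \<subseteq> UNIV \<times> insert t Y" "length w \<le> k" "k + length w \<le> N"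
  shows "\<exists>k' b. k' \<le> k + length w \<and> k \<le> k' + length w \<and> b \<in> M \<and>
           (\<forall>z\<in>states. (lift ^^ k') (act w z) = shift b ((lift ^^ k) z))"
  using w
proof (induction w)
  case Nil
  have "\<one> \<in> M"
    using M by (simp add: normal_imp_subgroup subgroup.one_closed)
  then show ?case by (intro exI[of _ k] exI[of _ \<one>]) auto
next
  case (Cons a w)
  have MG: "M \<subseteq> carrier G"
    using M by (simp add: normal_imp_subgroup subgroup.subset)
  have wS: "set w \<subseteq> UNIV \<times> carrier G"
    using Cons.prems(1) MG Y by fastforce
  obtain k' b where k': "k' \<le> k + length w" "k \<le> k' + length w" "b \<in> M"
    and eq: "\<And>z. z \<in> states \<Longrightarrow> (lift ^^ k') (act w z) = shift b ((lift ^^ k) z)"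
    using Cons by auto
  consider "a = (True, t)" | "a = (False, t)" | "snd a \<in> Y" "snd a \<noteq> t"
    using Cons.prems(1) by (cases a) auto
  then show ?case
  proof cases
    case 1
    \<comment> \<open>The starting exponent is at least the length of the whole word, so after the
      shorter suffix \<open>w\<close> it is still positive and one lift can be given to the letter
      \<open>t\<close>.\<close>
    obtain l where l: "k' = Suc l"
      using k' Cons.prems by (cases k') auto
    have "(lift ^^ l) (act (a # w) z) = shift b ((lift ^^ k) z)" if "z \<in> states" for z
      using eq[OF that] 1 by (simp add: l step_def funpow_swap1)
    then show ?thesis
      using k' l by (intro exI[of _ l] exI[of _ b]) auto
  next
    case 2
    have "(lift ^^ Suc k') (act (a # w) z) = shift b ((lift ^^ k) z)" if "z \<in> states" for z
      using eq[OF that] 2 that act_closed[OF wS that]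
      by (simp add: step_def funpow_Suc_right del: funpow.simps(2))
    then show ?thesis
      using k' by (intro exI[of _ "Suc k'"] exI[of _ b]) auto
  next
    case 3
    define c where "c = (if fst a then snd a else inv (snd a))"
    have aM: "snd a \<in> M" "snd a \<in> carrier G" using 3 Y MG by auto
    then have c: "c \<in> M" "c \<in> carrier G"
      using M by (auto simp: c_def normal_imp_subgroup subgroup.m_inv_closed)
    \<comment> \<open>The exponent has risen by at most one per letter, so \<open>k'\<close> has not
      passed \<open>N\<close> and all conjugates met on the way are in \<open>A\<close>.\<close>
    have cA: "t [^] j \<otimes> c \<otimes> inv (t [^] j) \<in> A" if "j < k'" for j
    proof -
      have "t [^] j \<otimes> snd a \<otimes> inv (t [^] j) \<in> A"
        using conj[OF 3(1), of j] that k' Cons.prems by auto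
      moreover have "t [^] j \<otimes> inv (snd a) \<otimes> inv (t [^] j) = inv (t [^] j \<otimes> snd a \<otimes> inv (t [^] j))"
        using aM by (simp add: inv_mult_group m_assoc)
      ultimately show ?thesis
        using subgroup.m_inv_closed[OF subgroup_A] by (auto simp: c_def)
    qed
    define d where "d = t [^] k' \<otimes> c \<otimes> inv (t [^] k')"
    have d: "d \<in> M" "d \<in> carrier G"
      using c normal.inv_op_closed2[OF M] by (auto simp: d_def)
    have "(lift ^^ k') (act (a # w) z) = shift (d \<otimes> b) ((lift ^^ k) z)" if z: "z \<in> states" for z
    proof -
      have "(lift ^^ k') (act (a # w) z) = (lift ^^ k') (shift c (act w z))"
        using 3 by (simp add: step_def c_def)
      also have "\<dots> = shift d (shift b ((lift ^^ k) z))"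
        using lift_pow_shift[OF c(2) act_closed[OF wS z] cA] eq[OF z] by (simp add: d_def)
      also have "\<dots> = shift (d \<otimes> b) ((lift ^^ k) z)"
        using d k' z MG by auto
      finally show ?thesis .
    qed
    then show ?thesis
      using k' d M by (intro exI[of _ k'] exI[of _ "d \<otimes> b"])
        (auto simp: normal_imp_subgroup subgroup.m_closed)
  qed
qed

lemma fst_lift_pow: "z \<in> states \<Longrightarrow> fst ((lift ^^ k) z) = t [^] k \<otimes> fst z"
proof (induction k)
  case (Suc k)
  then have "fst z \<in> carrier G" by (auto simp: states_def)
  then show ?case
    using Suc nat_pow_Suc2[OF t_closed, of k] by (simp add: lift_def m_assoc del: nat_pow_Suc)
qed (auto simp: states_def)

text \<open>Starting \<open>act_bounded_word\<close> at exponent \<open>length w\<close> keeps all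
  exponents between 0 and \<open>2 * length w\<close>. For a relator the first coordinates then
  force \<open>k' = k\<close> and \<open>b = \<one>\<close>, and injectivity of the power of
  \<open>lift\<close> on states finishes the argument.\<close>

lemma act_short_relator:
  assumes M: "M \<lhd> G" and Y: "Y \<subseteq> M"
    and conj: "\<And>m j. m \<in> Y \<Longrightarrow> j < N \<Longrightarrow> t [^] j \<otimes> m \<otimes> inv (t [^] j) \<in> A"
    and tM: "\<And>j::nat. t [^] j \<in> M \<Longrightarrow> j = 0"
    and w: "set w \<subseteq> UNIV \<times> insert t Y" "2 * length w \<le> N" "word_eval G (\<lambda>x. x) w = \<one>"
    and z: "z \<in> states"
  shows "act w z = z"
proof -
  define k where "k = length w"
  obtain k' b where b: "b \<in> M"
    and eq: "\<And>z. z \<in> states \<Longrightarrow> (lift ^^ k') (act w z) = shift b ((lift ^^ k) z)"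
    using act_bounded_word[OF M Y conj w(1), of N k] w(2) by (auto simp: k_def)
  have MG: "subgroup M G" using M by (simp add: normal_imp_subgroup)
  have bG: "b \<in> carrier G" using b subgroup.mem_carrier[OF MG] by simp
  have wS: "set w \<subseteq> UNIV \<times> carrier G"
    using w(1) Y subgroup.subset[OF MG] by fastforce
  have z0: "(\<one>, []) \<in> states" by (simp add: states_def)
  \<comment> \<open>Comparing first coordinates at the base state; modulo \<open>M\<close> this is
    an equation between powers of \<open>t\<close>.\<close>
  have "t [^] k' = b \<otimes> t [^] k"
    using arg_cong[OF eq[OF z0], of fst] fst_lift_pow[OF z0] fst_lift_pow[OF act_closed[OF wS z0]]
      fst_act[OF wS z0] w(3) by (simp add: shift_def)
  have "k' = k"
  proof (cases "k \<le> k'")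
    case True
    then have "t [^] (k' - k) \<otimes> t [^] k = b \<otimes> t [^] k"
      using \<open>t [^] k' = b \<otimes> t [^] k\<close> by (simp add: nat_pow_mult)
    then have "t [^] (k' - k) \<in> M" using b bG by simp
    then show ?thesis using tM[of "k' - k"] True by simp
  next
    case False
    then have "t [^] k = t [^] (k - k') \<otimes> t [^] k'"
      by (simp add: nat_pow_mult)
    then have "\<one> \<otimes> t [^] k' = b \<otimes> t [^] (k - k') \<otimes> t [^] k'"
      using \<open>t [^] k' = b \<otimes> t [^] k\<close> bG by (metis l_one m_assoc nat_pow_closed t_closed)
    then have "b \<otimes> t [^] (k - k') = \<one>"
      using bG by (metis m_closed nat_pow_closed one_closed right_cancel t_closed)
    then have "t [^] (k - k') = inv b"
      using bG by (metis inv_closed inv_equality inv_inv nat_pow_closed t_closed)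
    then have "t [^] (k - k') \<in> M" using b subgroup.m_inv_closed[OF MG] by simp
    then show ?thesis using tM[of "k - k'"] False by simp
  qed
  then have "b = \<one>"
    using \<open>t [^] k' = b \<otimes> t [^] k\<close> bG
    by (metis l_one nat_pow_closed one_closed right_cancel t_closed)
  then have "(lift ^^ k) (act w z) = (lift ^^ k) z"
    using eq[OF z] \<open>k' = k\<close> z by simp
  then show ?thesis
    using lower_pow_lift_pow z act_closed[OF wS z] by metis
qed

end

section \<open>The words substituted into the law\<close>

definition end_index :: "bool \<times> nat \<Rightarrow> nat" where
  "end_index a = (if fst a then 2 * snd a else 2 * snd a + 1)"

definition conj_word :: "'a \<Rightarrow> nat \<Rightarrow> bool \<times> 'a \<Rightarrow> (bool \<times> 'a) list" where
  "conj_word t N a = replicate N (True, t) @ a # replicate N (False, t)"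

text \<open>Here the generator \<open>x\<close> is such that \<open>t^N x t^-N\<close> lies outside \<open>A\<close>. The exponents at the two ends
  are injective in the signed letter, so a power of \<open>t\<close> with nonzero exponent survives between the
  blocks of two letters that do not cancel.\<close>

definition free_word :: "'a \<Rightarrow> nat \<Rightarrow> 'a \<Rightarrow> 'a \<Rightarrow> bool \<times> nat \<Rightarrow> (bool \<times> 'a) list" where
  "free_word t N x y a =
     replicate (end_index a) (True, t) @ conj_word t N (True, x) @ [(False, t), (fst a, y), (True, t)]
       @ conj_word t N (False, x) @ replicate (end_index (letter_inv a)) (False, t)"

lemma end_index_inject: "end_index a = end_index b \<longleftrightarrow> a = b"
proof
  assume "end_index a = end_index b"
  then have "fst a = fst b \<and> snd a = snd b"
    unfolding end_index_def by (auto split: if_splits) presburger+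
  then show "a = b" by (simp add: prod_eq_iff)
qed simp

lemma set_free_word: "set (free_word t N x y a) \<subseteq> UNIV \<times> {t, x, y}"
  by (auto simp: free_word_def conj_word_def)

lemma length_free_word: "length (free_word t N x y a) = 4 * snd a + 4 * N + 6"
  by (simp add: free_word_def conj_word_def end_index_def letter_inv_def)

text \<open>This is why the right-hand exponent is the \<open>end_index\<close> of the inverse
  letter: one formula then covers the blocks of both signs, as \<open>word_eval_concat\<close>
  requires.\<close>

lemma free_word_letter_inv: "free_word t N x y (letter_inv a) = rev (map letter_inv (free_word t N x y a))"
  by (simp add: free_word_def conj_word_def letter_inv_def)

section \<open>Reduced products of the substituted words act nontrivially\<close>

context coset_extension
begin

text \<open>The lowers are undone by as many lifts, each passing a conjugate by some
  \<open>t [^] j\<close> with \<open>j < N\<close>, which lies in \<open>A\<close>. So the word acts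
  as a pure translation even if the final conjugate is outside \<open>A\<close>.\<close>

lemma act_conj_word:
  assumes x: "x \<in> carrier G" "x \<noteq> t" and z: "z \<in> states"
    and conj: "\<And>j. j < N \<Longrightarrow> t [^] j \<otimes> x \<otimes> inv (t [^] j) \<in> A"
  shows "act (conj_word t N (True, x)) z = shift (t [^] N \<otimes> x \<otimes> inv (t [^] N)) z"
    and "act (conj_word t N (False, x)) z = shift (inv (t [^] N \<otimes> x \<otimes> inv (t [^] N))) z"
proof -
  have inv: "t [^] j \<otimes> inv x \<otimes> inv (t [^] j) = inv (t [^] j \<otimes> x \<otimes> inv (t [^] j))" for j :: nat
    using x by (simp add: inv_mult_group m_assoc)
  show "act (conj_word t N (True, x)) z = shift (t [^] N \<otimes> x \<otimes> inv (t [^] N)) z"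
    using lift_pow_shift[OF x(1) lower_pow_closed[OF z] conj, of N N] x z
    by (simp add: conj_word_def act_replicate step_def lift_pow_lower_pow)
  show "act (conj_word t N (False, x)) z = shift (inv (t [^] N \<otimes> x \<otimes> inv (t [^] N))) z"
    using lift_pow_shift[of "inv x" "(lower ^^ N) z" N] conj subgroup.m_inv_closed[OF subgroup_A] x z
    by (simp add: conj_word_def act_replicate step_def lift_pow_lower_pow inv)
qed

text \<open>Induction from the right end of the word. The leading power of \<open>t\<close> is kept
  apart in the invariant because it merges with the trailing power of the next block to the left;
  the state \<open>z\<close> below it ends in a lower that did not cancel.\<close>

lemma act_concat_free_word:
  assumes x: "x \<in> carrier G" "x \<noteq> t" and y: "y \<in> carrier G" "y \<noteq> t"
    and conj: "\<And>j. j < N \<Longrightarrow> t [^] j \<otimes> x \<otimes> inv (t [^] j) \<in> A"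
    and xA: "t [^] N \<otimes> x \<otimes> inv (t [^] N) \<notin> A" and yA: "inv t \<otimes> y \<otimes> t \<notin> A"
    and w: "reduced w" "w \<noteq> []" "\<And>a. a \<in> set w \<Longrightarrow> snd a \<ge> 1"
  shows "\<exists>z\<in>states. neg z \<and> act (concat (map (free_word t N x y) w)) (\<one>, []) =
           (lift ^^ end_index (hd w)) (shift (t [^] N \<otimes> x \<otimes> inv (t [^] N)) z)"
  using w
proof (induction w)
  case (Cons a w)
  define c where "c = t [^] N \<otimes> x \<otimes> inv (t [^] N)"
  have c: "c \<in> carrier G" "c \<notin> A" using x xA by (auto simp: c_def)
  then have c': "inv c \<in> carrier G" "inv c \<notin> A"
    using subgroup.m_inv_closed[OF subgroup_A, of "inv c"] by auto
  define b where "b = (if fst a then y else inv y)"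
  have "inv t \<otimes> inv y \<otimes> t = inv (inv t \<otimes> y \<otimes> t)"
    using y by (simp add: inv_mult_group m_assoc)
  then have b: "b \<in> carrier G" "inv t \<otimes> b \<otimes> t \<notin> A"
    using y yA subgroup.m_inv_closed[OF subgroup_A, of "inv (inv t \<otimes> y \<otimes> t)"]
    by (auto simp: b_def)
  define v where "v = act (concat (map (free_word t N x y) w)) (\<one>, [])"
  \<comment> \<open>\<open>q\<close> is reached after the trailing power of \<open>t\<close> in the
    block of \<open>a\<close>. All that matters about it is that its last surviving move did not
    cancel.\<close>
  define q where "q = (lower ^^ end_index (letter_inv a)) v"
  have "v \<in> states \<and> (neg q \<or> pos q)"
  proof (cases w)
    case Nil
    \<comment> \<open>Indices start at 1 so that this exponent is positive for both signs;
      \<open>2 * 0\<close> would leave no lower at all.\<close>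
    obtain l where l: "end_index (letter_inv a) = Suc l"
      using Cons.prems(3)[of a] by (cases "end_index (letter_inv a)")
        (auto simp: end_index_def letter_inv_def split: if_splits)
    show ?thesis
      using neg_lower_pow[of v l] neg_lower[of v]
      by (auto simp: v_def q_def Nil l states_def simp del: funpow.simps(2))
  next
    case (Cons d u)
    obtain z where z: "z \<in> states" "neg z" and v: "v = (lift ^^ end_index d) (shift c z)"
      using Cons.IH Cons.prems Cons by (auto simp: reduced_Cons v_def c_def)
    have vs: "v \<in> states" using z v c by simp
    have "d \<noteq> letter_inv a" using Cons.prems(1) Cons by (simp add: reduced_Cons)
    then consider "end_index d < end_index (letter_inv a)" | "end_index d > end_index (letter_inv a)"
      using end_index_inject[of d "letter_inv a"] by linarith
    then show ?thesis
    proof cases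
      case 1
      then obtain l where l: "end_index (letter_inv a) = Suc l + end_index d"
        using that[of "end_index (letter_inv a) - end_index d - 1"] by simp
      \<comment> \<open>Lowers survive the merging. They stack on the \<open>False\<close> head of
        \<open>z\<close>, whatever \<open>c\<close> is.\<close>
      have "q = (lower ^^ Suc l) (shift c z)"
        using z c unfolding q_def v l funpow_add by (simp add: lower_pow_lift_pow)
      moreover have "neg (lower (shift c z))"
        using z by (intro neg_lower) (simp add: neg_def shift_def)
      ultimately show ?thesis using neg_lower_pow vs by simp
    next
      case 2
      then obtain l where l: "end_index d = end_index (letter_inv a) + Suc l"
        using that[of "end_index d - end_index (letter_inv a) - 1"] by simp
      \<comment> \<open>Lifts survive, and the first of them meets the \<open>False\<close> head of
        \<open>z\<close>; it does not cancel because \<open>c\<close> is outside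
        \<open>A\<close>.\<close>
      have "q = (lift ^^ Suc l) (shift c z)"
        using z c unfolding q_def v l funpow_add
        by (simp add: lower_pow_lift_pow del: funpow.simps(2))
      moreover have "pos (lift (shift c z))"
        using pos_lift_shift[OF z c] .
      ultimately show ?thesis using pos_lift_pow[of "shift c z"] z c vs by simp
    qed
  qed
  then have v: "v \<in> states" and q: "neg q \<or> pos q" by auto
  have qs: "q \<in> states" using v by (simp add: q_def)
  \<comment> \<open>If \<open>q\<close> ends in a lower, \<open>inv c\<close> outside
    \<open>A\<close> prevents a pinch; if it ends in a lift, the new lift simply stacks.\<close>
  have p: "pos (lift (shift (inv c) q))"
    using q
  proof
    assume "neg q"
    then show ?thesis using pos_lift_shift[OF qs _ c'] by simp
  next
    assume "pos q"
    then show ?thesis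
      using qs c' by (intro pos_lift shift_closed) (simp_all add: pos_def shift_def)
  qed
  define r where "r = lift (shift (inv c) q)"
  have r: "r \<in> states" using qs c' by (simp add: r_def)
  have "act (concat (map (free_word t N x y) (a # w))) (\<one>, []) =
      (lift ^^ end_index a) (shift c (lower (shift b r)))"
  proof -
    have "act (concat (map (free_word t N x y) (a # w))) (\<one>, []) = act (free_word t N x y a) v"
      by (simp add: v_def)
    also have "\<dots> = (lift ^^ end_index a) (act (conj_word t N (True, x))
        (lower (shift b (lift (act (conj_word t N (False, x)) q)))))"
      using y by (simp add: free_word_def act_replicate step_def q_def b_def)
    also have "\<dots> = (lift ^^ end_index a) (act (conj_word t N (True, x)) (lower (shift b r)))"
      using act_conj_word(2)[OF x qs conj] by (simp add: r_def c_def)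
    also have "\<dots> = (lift ^^ end_index a) (shift c (lower (shift b r)))"
      using act_conj_word(1)[OF x _ conj, of "lower (shift b r)"] r b by (simp add: c_def)
    finally show ?thesis .
  qed
  moreover have "neg (lower (shift b r))"
    using neg_lower_shift[OF r _ b] p by (simp add: r_def)
  moreover have "lower (shift b r) \<in> states"
    using r b by simp
  ultimately show ?case
    unfolding c_def by (intro bexI[of _ "lower (shift b r)"]) auto
qed simp

text \<open>The leading exponent is positive as well, so a lift follows the translation by
  \<open>c\<close>. It does not cancel, and the second coordinate stays nonempty.\<close>

lemma act_concat_free_word_neq:
  assumes x: "x \<in> carrier G" "x \<noteq> t" and y: "y \<in> carrier G" "y \<noteq> t"
    and conj: "\<And>j. j < N \<Longrightarrow> t [^] j \<otimes> x \<otimes> inv (t [^] j) \<in> A"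
    and xA: "t [^] N \<otimes> x \<otimes> inv (t [^] N) \<notin> A" and yA: "inv t \<otimes> y \<otimes> t \<notin> A"
    and w: "reduced w" "w \<noteq> []" "\<And>a. a \<in> set w \<Longrightarrow> snd a \<ge> 1"
  shows "act (concat (map (free_word t N x y) w)) (\<one>, []) \<noteq> (\<one>, [])"
proof -
  define c where "c = t [^] N \<otimes> x \<otimes> inv (t [^] N)"
  have c: "c \<in> carrier G" "c \<notin> A" using x xA by (auto simp: c_def)
  obtain z where z: "z \<in> states" "neg z"
    and eq: "act (concat (map (free_word t N x y) w)) (\<one>, []) = (lift ^^ end_index (hd w)) (shift c z)"
    using act_concat_free_word[OF x y conj xA yA w] by (auto simp: c_def)
  obtain l where "end_index (hd w) = Suc l"
    using w(3)[of "hd w"] w(2) by (cases "end_index (hd w)") (auto simp: end_index_def split: if_splits)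
  then have "pos ((lift ^^ end_index (hd w)) (shift c z))"
    using pos_lift_pow[of "shift c z" l] pos_lift_shift[OF z c] z c by simp
  then show ?thesis
    unfolding eq[symmetric] by (auto simp: pos_def)
qed

end

section \<open>Semidirect products with the integers and a criterion for contraction\<close>

locale semidirect_product_int = group G for G (structure) +
  fixes M :: "'a set" and \<sigma> :: "int \<Rightarrow> 'a" and \<pi> :: "'a \<Rightarrow> int"
  assumes semidirect: "semidirect_int G M \<sigma> \<pi>"
begin

lemma M_normal: "M \<lhd> G"
  using semidirect by (simp add: semidirect_int_def)

lemma M_subgroup: "subgroup M G"
  using M_normal by (simp add: normal_imp_subgroup)

lemma M_closed: "m \<in> M \<Longrightarrow> m \<in> carrier G"
  using subgroup.mem_carrier[OF M_subgroup] .

lemma section_exhaust: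
  assumes "g \<in> carrier G"
  obtains m k where "m \<in> M" "g = m \<otimes> \<sigma> k"
proof -
  obtain Q where Q: "M <#> Q = carrier G" "\<sigma> \<in> iso integer_group (G\<lparr>carrier := Q\<rparr>)"
    using semidirect by (auto simp: semidirect_int_def)
  then have "\<sigma> ` UNIV = Q" by (auto simp: iso_def bij_betw_def)
  then show ?thesis using that assms Q(1) by (force simp: set_mult_def)
qed

lemma section_closed [simp]: "\<sigma> k \<in> carrier G"
proof -
  obtain Q where Q: "subgroup Q G" "\<sigma> \<in> iso integer_group (G\<lparr>carrier := Q\<rparr>)"
    using semidirect by (auto simp: semidirect_int_def)
  then have "\<sigma> k \<in> Q" by (auto simp: iso_def bij_betw_def)
  then show ?thesis using subgroup.mem_carrier[OF Q(1)] by simp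
qed

lemma section_add: "\<sigma> (i + j) = \<sigma> i \<otimes> \<sigma> j"
proof -
  obtain Q where Q: "\<sigma> \<in> iso integer_group (G\<lparr>carrier := Q\<rparr>)"
    using semidirect by (auto simp: semidirect_int_def)
  then show ?thesis by (auto simp: iso_def hom_def)
qed

lemma section_0 [simp]: "\<sigma> 0 = \<one>"
  using section_add[of 0 0] by simp

lemma section_minus: "\<sigma> (- k) = inv (\<sigma> k)"
  using section_add[of "- k" k] by (simp add: inv_equality)

lemma section_nat_pow: "\<sigma> e [^] (n::nat) = \<sigma> (e * int n)"
proof (induction n)
  case (Suc n)
  have "e * int (Suc n) = e * int n + e" by (simp add: algebra_simps)
  then show ?case using Suc by (simp add: section_add del: of_nat_Suc)
qed simp

lemma section_in_M: "\<sigma> k \<in> M \<longleftrightarrow> k = 0"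
proof
  assume k: "\<sigma> k \<in> M"
  obtain Q where Q: "M \<inter> Q = {\<one>}" "\<sigma> \<in> iso integer_group (G\<lparr>carrier := Q\<rparr>)"
    using semidirect by (auto simp: semidirect_int_def)
  then have "\<sigma> k \<in> Q" "inj \<sigma>" by (auto simp: iso_def bij_betw_def)
  then have "\<sigma> k = \<sigma> 0" using k Q(1) by auto
  then show "k = 0" using \<open>inj \<sigma>\<close> by (rule injD[rotated])
qed (simp add: subgroup.one_closed[OF M_subgroup])

lemma projection_section [simp]: "\<pi> (\<sigma> k) = k"
proof -
  have "\<pi> (\<one> \<otimes> \<sigma> k) = k"
    using semidirect subgroup.one_closed[OF M_subgroup] by (auto simp: semidirect_int_def)
  then show ?thesis by simp
qed

lemma section_in_subgroup:
  assumes H: "subgroup H G" and e: "e \<in> {1, -1}" "\<sigma> e \<in> H"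
  shows "\<sigma> k \<in> H"
proof -
  have nat: "\<sigma> (e * int n) \<in> H" for n
    unfolding section_nat_pow[symmetric]
    by (induction n) (simp_all add: subgroup.one_closed[OF H] subgroup.m_closed[OF H] e(2))
  have "\<exists>n. k = e * int n \<or> k = - (e * int n)"
    using e(1) by (intro exI[of _ "nat \<bar>k\<bar>"]) auto
  then show ?thesis
    using nat subgroup.m_inv_closed[OF H] by (auto simp: section_minus)
qed

text \<open>Each generator is replaced by its factor in \<open>M\<close>; the other factor is a
  power of either generator of the integers. Both signs are needed, since contraction may occur in
  either direction.\<close>

lemma finite_generators_in_M:
  assumes "finitely_generated G"
  obtains Y where "finite Y" "Y \<subseteq> M"
    "\<And>e. e \<in> {1, -1} \<Longrightarrow> generate G (insert (\<sigma> e) Y) = carrier G"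
proof -
  obtain S where S: "finite S" "S \<subseteq> carrier G" "generate G S = carrier G"
    using assms by (auto simp: finitely_generated_def)
  have "\<forall>s\<in>S. \<exists>m k. m \<in> M \<and> s = m \<otimes> \<sigma> k"
    using S(2) section_exhaust by blast
  then obtain m k where mk: "\<And>s. s \<in> S \<Longrightarrow> m s \<in> M \<and> s = m s \<otimes> \<sigma> (k s)"
    by metis
  have "generate G (insert (\<sigma> e) (m ` S)) = carrier G" if e: "e \<in> {1, -1}" for e
  proof -
    let ?T = "insert (\<sigma> e) (m ` S)"
    have T: "?T \<subseteq> carrier G" using mk M_closed by auto
    have H: "subgroup (generate G ?T) G" by (rule generate_is_subgroup[OF T])
    have "s \<in> generate G ?T" if "s \<in> S" for s
    proof -
      have "m s \<in> generate G ?T" using that by (simp add: generate.incl)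
      moreover have "\<sigma> (k s) \<in> generate G ?T"
        using section_in_subgroup[OF H e] by (simp add: generate.incl)
      ultimately show ?thesis using mk[OF that] subgroup.m_closed[OF H] by metis
    qed
    then have "generate G S \<subseteq> generate G ?T"
      by (intro generate_subgroup_incl[OF _ H]) auto
    then show ?thesis using S(3) generate_incl[OF T] by auto
  qed
  then show thesis using that[of "m ` S"] S(1) mk by auto
qed

text \<open>The conjugates of \<open>H = generate G C\<close> increase by \<open>conj\<close>. They
  exhaust \<open>M\<close> because the elements eventually conjugated into \<open>H\<close>,
  multiplied by powers of \<open>\<sigma> e\<close>, already give all of \<open>G\<close>.\<close>

lemma contracts_into_fgI:
  assumes e: "e \<in> {1, -1}"
    and C: "finite C" "C \<subseteq> M"
    and Y: "Y \<subseteq> generate G C"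
    and gen: "generate G (insert (\<sigma> e) Y) = carrier G"
    and conj: "\<And>h. h \<in> generate G C \<Longrightarrow> \<sigma> e \<otimes> h \<otimes> inv (\<sigma> e) \<in> generate G C"
  shows "contracts_into_fg G M \<pi>"
proof -
  define s where "s = \<sigma> e"
  define H where "H = generate G C"
  define \<tau> where "\<tau> k = \<sigma> (e * k)" for k
  have CG: "C \<subseteq> carrier G" using C M_closed by auto
  have H: "subgroup H G" unfolding H_def by (rule generate_is_subgroup[OF CG])
  have HM: "H \<subseteq> M" unfolding H_def by (rule generate_subgroup_incl[OF C(2) M_subgroup])
  have HG: "h \<in> carrier G" if "h \<in> H" for h using that HM M_closed by auto
  have \<tau>: "\<tau> k \<in> carrier G" "\<tau> (i + j) = \<tau> i \<otimes> \<tau> j" "\<tau> (- k) = inv (\<tau> k)" "\<tau> 0 = \<one>" "\<tau> 1 = s"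
    "s [^] n = \<tau> (int n)" for k i j and n :: nat
    by (auto simp: \<tau>_def s_def section_add section_minus section_nat_pow distrib_left)
  have sG: "s \<in> carrier G" by (simp add: s_def)
  have sHs: "s \<otimes> h \<otimes> inv s \<in> H" if "h \<in> H" for h
    using conj[of h] that by (simp add: H_def s_def)
  have pow_conj: "\<tau> (int j) \<otimes> h \<otimes> inv (\<tau> (int j)) \<in> H" if "h \<in> H" for h j
  proof (induction j)
    case 0
    then show ?case using that HG \<tau> by simp
  next
    case (Suc j)
    have "s \<otimes> (\<tau> (int j) \<otimes> h \<otimes> inv (\<tau> (int j))) \<otimes> inv s
        = \<tau> (int (Suc j)) \<otimes> h \<otimes> inv (\<tau> (int (Suc j)))"
      using HG[OF that] \<tau>(1) sG \<tau>(2)[of 1 "int j"] \<tau>(5)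
      by (simp add: m_assoc inv_mult_group)
    then show ?case using sHs[OF Suc] by simp
  qed
  define P where
    \<comment> \<open>Asking for all large \<open>j\<close> gives products the common threshold
      \<open>max N1 N2\<close>. The threshold is an integer because conjugation by
      \<open>\<tau> k\<close> shifts it by \<open>- k\<close>.\<close>
    "P u \<longleftrightarrow> u \<in> carrier G \<and> (\<exists>N::int. \<forall>j\<ge>N. \<tau> j \<otimes> u \<otimes> inv (\<tau> j) \<in> H)" for u
  have P_H: "P h" if "h \<in> H" for h
    unfolding P_def
  proof (intro conjI exI allI impI)
    fix j :: int assume "0 \<le> j"
    then show "\<tau> j \<otimes> h \<otimes> inv (\<tau> j) \<in> H" using pow_conj[OF that, of "nat j"] by simp
  qed (use HG that in simp)
  have P_inv: "P (inv u)" if "P u" for u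
  proof -
    have "\<tau> j \<otimes> inv u \<otimes> inv (\<tau> j) = inv (\<tau> j \<otimes> u \<otimes> inv (\<tau> j))" for j
      using that \<tau> by (simp add: P_def inv_mult_group m_assoc)
    then show ?thesis
      using that subgroup.m_inv_closed[OF H] by (auto simp: P_def)
  qed
  have P_mult: "P (u \<otimes> v)" if uv_P: "P u" "P v" for u v
  proof -
    have uv: "u \<in> carrier G" "v \<in> carrier G" using that by (auto simp: P_def)
    obtain N1 N2 where N: "\<And>j. j \<ge> N1 \<Longrightarrow> \<tau> j \<otimes> u \<otimes> inv (\<tau> j) \<in> H"
      "\<And>j. j \<ge> N2 \<Longrightarrow> \<tau> j \<otimes> v \<otimes> inv (\<tau> j) \<in> H"
      using uv_P unfolding P_def by blast
    have "\<tau> j \<otimes> (u \<otimes> v) \<otimes> inv (\<tau> j) = (\<tau> j \<otimes> u \<otimes> inv (\<tau> j)) \<otimes> (\<tau> j \<otimes> v \<otimes> inv (\<tau> j))" for j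
      using uv \<tau>(1)[of j] by (simp add: m_assoc inv_solve_left)
    then have "\<tau> j \<otimes> (u \<otimes> v) \<otimes> inv (\<tau> j) \<in> H" if "j \<ge> max N1 N2" for j
      using N[of j] that subgroup.m_closed[OF H] by simp
    then show ?thesis using uv unfolding P_def by blast
  qed
  have P_conj: "P (\<tau> k \<otimes> u \<otimes> inv (\<tau> k))" if Pu: "P u" for u k
  proof -
    have u: "u \<in> carrier G" using Pu by (auto simp: P_def)
    obtain N where N: "\<And>j. j \<ge> N \<Longrightarrow> \<tau> j \<otimes> u \<otimes> inv (\<tau> j) \<in> H"
      using Pu unfolding P_def by blast
    have "\<tau> j \<otimes> (\<tau> k \<otimes> u \<otimes> inv (\<tau> k)) \<otimes> inv (\<tau> j) = \<tau> (j + k) \<otimes> u \<otimes> inv (\<tau> (j + k))" for j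
      using u \<tau>(1)[of j] \<tau>(1)[of k] by (simp add: \<tau>(2) m_assoc inv_mult_group)
    then have "\<tau> j \<otimes> (\<tau> k \<otimes> u \<otimes> inv (\<tau> k)) \<otimes> inv (\<tau> j) \<in> H" if "j \<ge> N - k" for j
      using N[of "j + k"] that by simp
    then show ?thesis using u \<tau>(1)[of k] unfolding P_def by blast
  qed
  \<comment> \<open>Closure of \<open>P\<close> under products and under conjugation by every
    \<open>\<tau> k\<close> makes the elements \<open>u \<otimes> \<tau> k\<close> closed under
    multiplication.\<close>
  have decomp: "\<exists>u k. P u \<and> g = u \<otimes> \<tau> k" if "g \<in> generate G (insert s Y)" for g
    using that
  proof (induction g rule: generate.induct)
    case one
    show ?case
      using P_H[OF subgroup.one_closed[OF H]] \<tau>(4) by (intro exI[of _ \<one>] exI[of _ 0]) simp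
  next
    case (incl h)
    show ?case
    proof (cases "h = s")
      case True
      then show ?thesis
        using P_H[OF subgroup.one_closed[OF H]] \<tau>(5) sG by (intro exI[of _ \<one>] exI[of _ 1]) simp
    next
      case False
      then have "h \<in> H" using incl Y by (auto simp: H_def)
      then show ?thesis using P_H[of h] HG \<tau>(4) by (intro exI[of _ h] exI[of _ 0]) simp
    qed
  next
    case (inv h)
    show ?case
    proof (cases "h = s")
      case True
      then show ?thesis
        using P_H[OF subgroup.one_closed[OF H]] \<tau>(3)[of 1] \<tau>(5) sG
        by (intro exI[of _ \<one>] exI[of _ "-1"]) simp
    next
      case False
      then have "h \<in> H" using inv Y by (auto simp: H_def)
      then show ?thesis
        using P_inv[OF P_H[of h]] HG \<tau>(4) by (intro exI[of _ "inv h"] exI[of _ 0]) simp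
    qed
  next
    case (eng h1 h2)
    obtain u1 k1 u2 k2 where u: "P u1" "h1 = u1 \<otimes> \<tau> k1" "P u2" "h2 = u2 \<otimes> \<tau> k2"
      using eng by blast
    have "u1 \<in> carrier G" "u2 \<in> carrier G" using u by (auto simp: P_def)
    then have "h1 \<otimes> h2 = (u1 \<otimes> (\<tau> k1 \<otimes> u2 \<otimes> inv (\<tau> k1))) \<otimes> \<tau> (k1 + k2)"
      using \<tau>(1)[of k1] \<tau>(1)[of k2] by (simp add: u \<tau>(2) m_assoc inv_solve_left)
    then show ?case using P_mult[OF u(1) P_conj[OF u(3)]] by blast
  qed
  have P_M: "u \<in> M" if Pu: "P u" for u
  proof -
    obtain j where j: "u \<in> carrier G" "\<tau> j \<otimes> u \<otimes> inv (\<tau> j) \<in> M"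
      using Pu HM unfolding P_def by blast
    have "inv (\<tau> j) \<otimes> (\<tau> j \<otimes> u \<otimes> inv (\<tau> j)) \<otimes> \<tau> j = u"
      using j(1) \<tau>(1)[of j] by (simp add: m_assoc inv_solve_left')
    then show ?thesis
      using normal.inv_op_closed1[OF M_normal \<tau>(1)[of j] j(2)] by simp
  qed
  \<comment> \<open>Since \<open>P\<close> implies membership in \<open>M\<close>, the power of
    \<open>s\<close> in the decomposition of an element of \<open>M\<close> is itself in
    \<open>M\<close>, hence trivial.\<close>
  have M_P: "P m" if m: "m \<in> M" for m
  proof -
    obtain u k where u: "P u" "m = u \<otimes> \<tau> k"
      using decomp[of m] gen M_closed[OF m] by (auto simp: s_def)
    have uM: "u \<in> M" using P_M u by simp
    have "inv u \<otimes> m = \<tau> k"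
      using u M_closed[OF uM] \<tau>(1)[of k] by (simp flip: m_assoc)
    then have "\<tau> k \<in> M"
      using uM m subgroup.m_closed[OF M_subgroup] subgroup.m_inv_closed[OF M_subgroup] by metis
    then have "k = 0" using e by (auto simp: \<tau>_def section_in_M)
    then show ?thesis using u \<tau>(4) M_closed[OF uM] by simp
  qed
  define K where "K n = (\<lambda>h. inv (s [^] n) \<otimes> h \<otimes> s [^] n) ` H" for n :: nat
  have "K n \<subseteq> K (Suc n)" for n
  proof
    fix g assume "g \<in> K n"
    then obtain h where h: "h \<in> H" "g = inv (s [^] n) \<otimes> h \<otimes> s [^] n"
      by (auto simp: K_def)
    have "inv s \<otimes> (s \<otimes> v) = v" if "v \<in> carrier G" for v
      using that sG by (simp flip: m_assoc)
    then have "g = inv (s [^] Suc n) \<otimes> (s \<otimes> h \<otimes> inv s) \<otimes> s [^] Suc n"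
      using h(2) HG[OF h(1)] sG nat_pow_Suc2[OF sG, of n]
      by (simp add: m_assoc inv_mult_group del: nat_pow_Suc)
    then show "g \<in> K (Suc n)" using sHs[OF h(1)] unfolding K_def by blast
  qed
  then have "mono K" by (rule mono_iff_le_Suc[THEN iffD2, rule_format])
  moreover have "(\<Union>n. K n) = M"
  proof (intro equalityI subsetI)
    fix g assume "g \<in> (\<Union>n. K n)"
    then obtain n :: nat and h where h: "h \<in> H" "g = inv (s [^] n) \<otimes> h \<otimes> s [^] n"
      by (auto simp: K_def)
    then show "g \<in> M"
      using normal.inv_op_closed1[OF M_normal, of "s [^] n" h] HM sG by auto
  next
    fix m assume m: "m \<in> M"
    obtain N where N: "\<And>j. j \<ge> N \<Longrightarrow> \<tau> j \<otimes> m \<otimes> inv (\<tau> j) \<in> H"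
      using M_P[OF m] unfolding P_def by blast
    define n where "n = nat N"
    have "s [^] n \<otimes> m \<otimes> inv (s [^] n) \<in> H"
      using N[of "int n"] \<tau>(6) by (simp add: n_def)
    moreover have "m = inv (s [^] n) \<otimes> (s [^] n \<otimes> m \<otimes> inv (s [^] n)) \<otimes> s [^] n"
    proof -
      have "inv (s [^] n) \<otimes> (s [^] n \<otimes> m) = m"
        using M_closed[OF m] sG by (simp flip: m_assoc)
      then show ?thesis using M_closed[OF m] sG by (simp add: m_assoc)
    qed
    ultimately show "m \<in> (\<Union>n. K n)" unfolding K_def by blast
  qed
  moreover have "finitely_generated (G\<lparr>carrier := H\<rparr>)"
    unfolding finitely_generated_def
    using C(1) generate_consistent[of C H] H generate.incl[of _ C G]
    by (intro exI[of _ C]) (auto simp: H_def)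
  moreover have "generate integer_group {\<pi> s} = carrier integer_group"
  proof -
    have "k \<in> generate integer_group {e}" for k
      using group.generate_pow[OF group_integer_group, of e] e
      by (auto intro: exI[of _ k] exI[of _ "- k"])
    then show ?thesis by (auto simp: s_def)
  qed
  ultimately show ?thesis
    unfolding contracts_into_fg_def Let_def K_def using sG H HM by blast
qed

end

section \<open>Elements of the relation range from relators of controlled length\<close>

lemma normal_closure_mono: "R \<subseteq> R' \<Longrightarrow> normal_closure G R \<subseteq> normal_closure G R'"
  by (auto simp: normal_closure_def)

lemma short_relators_closure_mono:
  "i \<le> j \<Longrightarrow> short_relators_closure G S i \<subseteq> short_relators_closure G S j"
  unfolding short_relators_closure_def by (rule normal_closure_mono) auto

text \<open>The closures grow with the level, so the first level containing \<open>w\<close> is one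
  where a proper inclusion occurs; it is at least \<open>n\<close> and at most the length of
  \<open>w\<close>.\<close>

lemma relation_range_witness:
  assumes w: "w \<in> relators G S" and n: "w \<notin> short_relators_closure G S (int n - 1)"
  shows "\<exists>r\<in>relation_range G S. n \<le> r \<and> r \<le> length w"
proof -
  let ?P = "\<lambda>r. w \<in> short_relators_closure G S (int r)"
  have len: "?P (length w)"
    using w by (auto simp: short_relators_closure_def normal_closure_def)
  define r where "r = (LEAST r. ?P r)"
  have r: "?P r" "r \<le> length w"
    unfolding r_def by (rule LeastI[of ?P, OF len], rule Least_le[of ?P, OF len])
  have nr: "n \<le> r"
    using r(1) n short_relators_closure_mono[of "int r" "int n - 1" G S] by force
  have "w \<notin> short_relators_closure G S (int r - 1)"
  \<comment> \<open>Natural subtraction would truncate here. But \<open>r = 0\<close> forces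
    \<open>n = 0\<close>, and the hypothesis already speaks of level -1.\<close>
  proof (cases "r = 0")
    case True
    then show ?thesis using n nr by simp
  next
    case False
    then show ?thesis
      using not_less_Least[of "r - 1" ?P] by (simp add: r_def[symmetric] of_nat_diff)
  qed
  then have "r \<in> relation_range G S"
    using r(1) short_relators_closure_mono[of "int r - 1" "int r" G S]
    by (auto simp: relation_range_def)
  then show ?thesis using nr r(2) by blast
qed

section \<open>The gap bound and the final dichotomy\<close>

context semidirect_product_int
begin

text \<open>The bound is linear in \<open>n\<close> with a factor read off from the law:
  \<open>length w\<close> blocks, each of length at most \<open>4 * k + 4 * N + 6\<close> with
  \<open>N = 2 * n\<close>.\<close>

lemma relation_range_gap_bound:
  assumes nc: "\<not> contracts_into_fg G M \<pi>"
    and Y: "finite Y" "Y \<subseteq> M"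
    and gen: "\<And>e. e \<in> {1, -1} \<Longrightarrow> generate G (insert (\<sigma> e) Y) = carrier G"
    and w: "w \<in> carrier (free_group {1..k})" "w \<noteq> []"
    and law: "\<And>g. g \<in> {1..k} \<rightarrow> carrier G \<Longrightarrow> word_eval G g w = \<one>"
    and n: "n \<ge> (1::nat)"
  shows "\<exists>r\<in>relation_range G (insert (\<sigma> 1) Y). n \<le> r \<and> r \<le> length w * (4 * k + 14) * n"
proof -
  define t where "t = \<sigma> 1"
  define N where "N = 2 * n"
  define S where "S = insert t Y"
  define C where "C = (\<lambda>(j::nat, m). t [^] j \<otimes> m \<otimes> inv (t [^] j)) ` ({..<N} \<times> Y)"
  define A where "A = generate G C"
  have tG: "t \<in> carrier G" by (simp add: t_def)
  have YG: "m \<in> carrier G" if "m \<in> Y" for m using that Y M_closed by auto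
  have SG: "S \<subseteq> carrier G" using tG YG by (auto simp: S_def)
  have C: "finite C" "C \<subseteq> M"
    using Y tG normal.inv_op_closed2[OF M_normal] by (auto simp: C_def)
  have CG: "C \<subseteq> carrier G" using C M_closed by auto
  have A: "subgroup A G" unfolding A_def by (rule generate_is_subgroup[OF CG])
  have conj: "t [^] j \<otimes> m \<otimes> inv (t [^] j) \<in> A" if "m \<in> Y" "j < N" for m and j :: nat
    using that unfolding A_def C_def by (intro generate.incl) auto
  have YA: "Y \<subseteq> A"
    using conj[of _ 0] n YG by (auto simp: N_def)
  \<comment> \<open>\<open>step\<close> recognises \<open>t\<close> by equality, so no generator in
    \<open>Y\<close> may coincide with it.\<close>
  have tY: "m \<noteq> t" if "m \<in> Y" for m
    using that Y section_in_M[of 1] by (auto simp: t_def)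
  \<comment> \<open>Conjugation by \<open>t\<close> raises the exponent of a generator of
    \<open>A\<close> by one and leaves the list only at \<open>N\<close>. Without such an
    \<open>x\<close> it would map \<open>A\<close> into itself, giving contraction with
    \<open>e = 1\<close>.\<close>
  obtain x where x: "x \<in> Y" "t [^] N \<otimes> x \<otimes> inv (t [^] N) \<notin> A"
  proof (rule ccontr)
    assume "\<not> thesis"
    then have top: "t [^] N \<otimes> m \<otimes> inv (t [^] N) \<in> A" if "m \<in> Y" for m
      using that \<open>\<And>x. \<lbrakk>x \<in> Y; t [^] N \<otimes> x \<otimes> inv (t [^] N) \<notin> A\<rbrakk> \<Longrightarrow> thesis\<close> by blast
    have "t \<otimes> c \<otimes> inv t \<in> A" if cC: "c \<in> C" for c
    proof -
      obtain j :: nat and m where c: "j < N" "m \<in> Y" "c = t [^] j \<otimes> m \<otimes> inv (t [^] j)"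
        using cC by (auto simp: C_def)
      have "t \<otimes> c \<otimes> inv t = t [^] Suc j \<otimes> m \<otimes> inv (t [^] Suc j)"
        using YG[OF c(2)] tG nat_pow_Suc2[OF tG, of j]
        by (simp add: c(3) m_assoc inv_mult_group del: nat_pow_Suc)
      then show ?thesis
        using conj[OF c(2), of "Suc j"] top[OF c(2)] c(1) by (cases "Suc j = N") auto
    qed
    then have "t \<otimes> h \<otimes> inv t \<in> A" if "h \<in> A" for h
      using conj_generate_subset[OF CG tG A] that by (simp add: A_def)
    then have "contracts_into_fg G M \<pi>"
      using contracts_into_fgI[of 1 C Y] C YA gen[of 1] by (simp add: A_def t_def)
    then show False using nc by simp
  qed
  \<comment> \<open>In the opposite direction only exponent 0 leaves the list, and failure gives
    contraction with \<open>e = -1\<close>.\<close>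
  obtain y where y: "y \<in> Y" "inv t \<otimes> y \<otimes> t \<notin> A"
  proof (rule ccontr)
    assume "\<not> thesis"
    then have bot: "inv t \<otimes> m \<otimes> t \<in> A" if "m \<in> Y" for m
      using that \<open>\<And>y. \<lbrakk>y \<in> Y; inv t \<otimes> y \<otimes> t \<notin> A\<rbrakk> \<Longrightarrow> thesis\<close> by blast
    have "inv t \<otimes> c \<otimes> inv (inv t) \<in> A" if cC: "c \<in> C" for c
    proof -
      obtain j :: nat and m where c: "j < N" "m \<in> Y" "c = t [^] j \<otimes> m \<otimes> inv (t [^] j)"
        using cC by (auto simp: C_def)
      show ?thesis
      proof (cases j)
        case 0
        then show ?thesis using bot[OF c(2)] YG[OF c(2)] tG c(3) by simp
      next
        case (Suc i)
        have "inv t \<otimes> c \<otimes> t = t [^] i \<otimes> m \<otimes> inv (t [^] i)"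
          using YG[OF c(2)] tG nat_pow_Suc2[OF tG, of i]
          by (simp add: c(3) Suc m_assoc inv_mult_group inv_solve_left' del: nat_pow_Suc)
        then show ?thesis using conj[OF c(2), of i] Suc c(1) tG by simp
      qed
    qed
    then have "inv t \<otimes> h \<otimes> inv (inv t) \<in> A" if "h \<in> A" for h
      using conj_generate_subset[OF CG inv_closed[OF tG] A] that by (simp add: A_def)
    then have "contracts_into_fg G M \<pi>"
      using contracts_into_fgI[of "-1" C Y] C YA gen[of "-1"]
      by (simp add: A_def t_def section_minus)
    then show False using nc by simp
  qed
  interpret coset_extension G A t
    by (intro coset_extension.intro coset_extension_axioms.intro is_group A tG)
  define U where "U = concat (map (free_word t N x y) w)"
  \<comment> \<open>Powers of \<open>t\<close> meet between consecutive blocks, so \<open>U\<close>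
    need not be reduced. Free reduction changes neither its value nor its action, and does not
    lengthen it.\<close>
  define W where "W = foldr cons_red U []"
  have wk: "reduced w" "\<And>a. a \<in> set w \<Longrightarrow> 1 \<le> snd a \<and> snd a \<le> k"
    using w(1) by (auto simp: free_group_def)
  have fw: "set (free_word t N x y a) \<subseteq> UNIV \<times> S" for a
    using set_free_word[of t N x y a] x y by (auto simp: S_def)
  then have US: "set U \<subseteq> UNIV \<times> S" by (auto simp: U_def)
  then have UG: "set U \<subseteq> UNIV \<times> carrier G" using SG by fastforce
  have idS: "(\<lambda>x. x) \<in> S \<rightarrow> carrier G" using SG by auto
  have "W \<in> carrier (free_group S)"
    using US set_foldr_cons_red[of U "[]"]
    by (auto simp: W_def free_group_def reduced_foldr_cons_red)
  moreover have "word_eval G (\<lambda>x. x) W = \<one>"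
  proof -
    have "word_eval G (\<lambda>x. x) W = word_eval G (\<lambda>x. x) U"
      unfolding W_def by (rule word_eval_foldr_cons_red_Nil[OF idS US])
    also have "\<dots> = word_eval G (\<lambda>i. word_eval G (\<lambda>x. x) (free_word t N x y (True, i))) w"
      unfolding U_def
    proof (rule word_eval_concat[OF idS])
      show "free_word t N x y (False, i) = rev (map letter_inv (free_word t N x y (True, i)))" for i
        using free_word_letter_inv[of t N x y "(True, i)"] by (simp add: letter_inv_def)
    qed (rule fw)
    also have "\<dots> = \<one>"
      using word_eval_closed[OF idS fw] by (intro law) auto
    finally show ?thesis .
  qed
  ultimately have WR: "W \<in> relators G S"
    by (simp add: relators_def kernel_def)
  have z0: "(\<one>, []) \<in> states" by (simp add: states_def)
  have "act W (\<one>, []) = act U (\<one>, [])"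
    unfolding W_def using act_foldr_cons_red[OF UG _ z0, of "[]"] by simp
  moreover have "act U (\<one>, []) \<noteq> (\<one>, [])"
    unfolding U_def
  proof (rule act_concat_free_word_neq)
    show "t [^] j \<otimes> x \<otimes> inv (t [^] j) \<in> A" if "j < N" for j
      using conj x that by simp
  qed (use x y wk w(2) tY YG in auto)
  ultimately have act_W: "act W (\<one>, []) \<noteq> (\<one>, [])" by simp
  have "W \<notin> short_relators_closure G S (int n - 1)"
  proof
    let ?K = "{w \<in> carrier (free_group S). \<forall>z\<in>states. act w z = z}"
    assume "W \<in> short_relators_closure G S (int n - 1)"
    moreover have "{w \<in> relators G S. int (length w) \<le> int n - 1} \<subseteq> ?K"
    proof clarify
      fix v assume v: "v \<in> relators G S" "int (length v) \<le> int n - 1"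
      then have "v \<in> carrier (free_group S)" and v1: "word_eval G (\<lambda>x. x) v = \<one>"
        by (auto simp: relators_def kernel_def)
      then have vS: "set v \<subseteq> UNIV \<times> insert t Y" by (auto simp: free_group_def S_def)
      have tM: "j = 0" if "t [^] j \<in> M" for j :: nat
        using that by (simp add: t_def section_nat_pow section_in_M)
      have "act v z = z" if "z \<in> states" for z
        using v(2) by (intro act_short_relator[OF M_normal Y(2) conj tM vS _ v1 that])
          (auto simp: N_def)
      then show "v \<in> carrier (free_group S) \<and> (\<forall>z\<in>states. act v z = z)"
        using \<open>v \<in> carrier (free_group S)\<close> by simp
    qed
    ultimately have "W \<in> ?K"
      using act_kernel_normal[OF SG] unfolding short_relators_closure_def normal_closure_def by blast
    then show False using act_W z0 by blast
  qed
  then obtain r where r: "r \<in> relation_range G S" "n \<le> r" "r \<le> length W"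
    using relation_range_witness[OF WR] by blast
  have "length W \<le> length U"
    using length_foldr_cons_red[of U "[]"] by (simp add: W_def)
  also have "length U = (\<Sum>a\<leftarrow>w. 4 * snd a + 4 * N + 6)"
    by (simp add: U_def length_concat length_free_word o_def)
  also have "\<dots> \<le> (\<Sum>a\<leftarrow>w. (4 * k + 14) * n)"
  proof (rule sum_list_mono)
    fix a assume "a \<in> set w"
    then have "4 * snd a \<le> 4 * k * n"
      using wk(2)[of a] n mult_le_mono[of "4 * snd a" "4 * k" 1 n] by simp
    then show "4 * snd a + 4 * N + 6 \<le> (4 * k + 14) * n"
      using n by (simp add: N_def algebra_simps)
  qed
  also have "\<dots> = length w * (4 * k + 14) * n"
    by (simp add: sum_list_triv)
  finally show ?thesis
    using r by (intro bexI[of _ r]) (auto simp: S_def t_def)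
qed

end

theorem theorem1p11:
  fixes G :: "('a, 'b) monoid_scheme"
    and M :: "'a set"
    and \<sigma> :: "int \<Rightarrow> 'a"
    and \<pi> :: "'a \<Rightarrow> int"
  assumes "semidirect_int G M \<sigma> \<pi>"
    and "finitely_generated G"
    and "satisfies_law G"
  shows "contracts_into_fg G M \<pi> \<or> densely_related G"
proof -
  interpret G: semidirect_product_int G M \<sigma> \<pi>
    using assms(1) by (simp add: semidirect_product_int_def semidirect_product_int_axioms_def
        semidirect_int_def)
  obtain Y where Y: "finite Y" "Y \<subseteq> M"
    "\<And>e. e \<in> {1, -1} \<Longrightarrow> generate G (insert (\<sigma> e) Y) = carrier G"
    using G.finite_generators_in_M[OF assms(2)] by blast
  obtain k :: nat and w where w: "w \<in> carrier (free_group {1..k})"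
      "w \<noteq> \<one>\<^bsub>free_group {1..k}\<^esub>"
    and law: "\<And>g. g \<in> {1..k} \<rightarrow> carrier G \<Longrightarrow> word_eval G g w = \<one>\<^bsub>G\<^esub>"
    using assms(3) unfolding satisfies_law_def by blast
  then have "w \<noteq> []" by (simp add: free_group_def)
  \<comment> \<open>\<open>w\<close> and \<open>k\<close> come from the law alone and
    \<open>Y\<close> is fixed beforehand, so this constant serves all \<open>n\<close>.\<close>
  define c where "c = real (length w * (4 * k + 14))"
  have "\<exists>r\<in>relation_range G (insert (\<sigma> 1) Y). real n \<le> real r \<and> real r \<le> c * real n"
    if nc: "\<not> contracts_into_fg G M \<pi>" and "n \<ge> 1" for n
  proof -
    obtain r where r: "r \<in> relation_range G (insert (\<sigma> 1) Y)" "n \<le> r"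
      "r \<le> length w * (4 * k + 14) * n"
      using G.relation_range_gap_bound[OF nc Y w(1) \<open>w \<noteq> []\<close> law \<open>n \<ge> 1\<close>] by blast
    then have "real r \<le> c * real n"
      unfolding c_def of_nat_mult[symmetric] of_nat_le_iff by simp
    then show ?thesis using r by auto
  qed
  moreover have "c > 0"
    using \<open>w \<noteq> []\<close> by (simp add: c_def)
  ultimately have "densely_related G" if "\<not> contracts_into_fg G M \<pi>"
    unfolding densely_related_def
    using that Y G.M_closed
    by (intro exI[of _ "insert (\<sigma> 1) Y"] conjI exI[of _ c]) auto
  then show ?thesis by blast
qed

end
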